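(* Let $J$ be a finite ground set, $\mathcal{F}\subseteq2^J$ a downward-closed (packing) family with convex relaxation $P_{\mathcal{F}}$, and let the objective be additive, $f(I,x)=\sum_{i\in I}x_i$. If there exists a $\frac1\alpha$-selectable online contention resolution scheme ($\alpha\ge1$) for $\mathcal{F}$ with respect to $P_{\mathcal{F}}$, then for every collection of DAG Markov systems $(S_i)_{i\in J}$ with non-negative destination values there is an adaptive strategy for the Utility Maximization problem that satisfies the commitment constraint and whose utility is at least $\frac1\alpha$ times the optimal utility achievable by any adaptive strategy without the commitment constraint.
   Context: A Markov system $S=(V,P,s,T,\pi,r)$ consists of a Markov chain on a finite state space $V$ with transition matrix $P=(p_{u,v})$, a starting state $s$, a set $T\subseteq V$ of absorbing destination states, prices $\pi^u\ge0$ for $u\in V\setminus T$, and values $r^t$ for $t\in T$; every state reaches some destination state. It is a DAG Markov system if the directed graph with an arc $u\to v$ whenever $u\notin T$ and $p_{u,v}>0$ is acyclic. Utility Maximization in the MPOI world: each $S_i$ starts at $s_i$; at each step the player either advances some $S_i$ from its current non-destination state $u$, paying $\pi_i^u$ (the state then moves randomly according to $P_i$), or ends the game by selecting a set $I\in\mathcal{F}$ of ready elements (elements whose Markov system is in a destination state). The utility of an adaptive strategy is $\mathbb{E}[\sum_{i\in I}r_i^{\mathrm{dest}(i)}-\text{total price paid}]$, where $\mathrm{dest}(i)$ is the destination reached by $S_i$. Commitment constraint: whenever the strategy stops advancing a Markov system $S_i$ (by advancing another system or ending the game), it must immediately and irrevocably decide whether $i$ is in the final solution (only ready elements can be selected;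 a non-ready element is discarded), and $S_i$ is not advanced afterwards; the final selected set must lie in $\mathcal{F}$. $P_{\mathcal{F}}\subseteq[0,1]^J$ is a convex set containing the indicator vectors of all sets in $\mathcal{F}$. Online contention resolution scheme (OCRS): for $x\in P_{\mathcal{F}}$, let $R(x)$ be a random set containing each $i$ independently with probability $x_i$; elements are revealed one by one (in any order) together with whether $i\in R(x)$, and the OCRS must decide irrevocably whether to select $i\in R(x)$ before the next element is revealed; it outputs $I\subseteq R(x)$ with $I\in\mathcal{F}$. It is $\frac1\alpha$-selectable if for every $x\in P_{\mathcal{F}}$ and every $i$, $\Pr[i\in I\mid i\in R(x)]\ge\frac1\alpha$. *)

theory Defs
  imports "HOL-Probability.Probability"
begin

section \<open>Markov systems\<close>

text \<open>A family of Markov systems S_i (i in J) over a common state type 'v is given by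
  state sets V i, transition distributions P i, start states s i, destination sets T i,
  prices pr i u (u non-destination) and values r i t (t destination).\<close>

definition ms_graph :: "'v set \<Rightarrow> ('v \<Rightarrow> 'v pmf) \<Rightarrow> 'v set \<Rightarrow> ('v \<times> 'v) set" where
  "ms_graph V P T = {(u, v). u \<in> V \<and> u \<notin> T \<and> v \<in> set_pmf (P u)}"

definition markov_system ::
  "'v set \<Rightarrow> ('v \<Rightarrow> 'v pmf) \<Rightarrow> 'v \<Rightarrow> 'v set \<Rightarrow> ('v \<Rightarrow> real) \<Rightarrow> ('v \<Rightarrow> real) \<Rightarrow> bool" where
  "markov_system V P s T pr r \<longleftrightarrow>
     finite V \<and> s \<in> V \<and> T \<subseteq> V \<and>
     (\<forall>u \<in> V - T. set_pmf (P u) \<subseteq> V) \<and>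
     (\<forall>u \<in> V - T. pr u \<ge> 0) \<and>
     (\<forall>u \<in> V. \<exists>t \<in> T. (u, t) \<in> (ms_graph V P T)\<^sup>*)"

definition dag_markov_system ::
  "'v set \<Rightarrow> ('v \<Rightarrow> 'v pmf) \<Rightarrow> 'v \<Rightarrow> 'v set \<Rightarrow> ('v \<Rightarrow> real) \<Rightarrow> ('v \<Rightarrow> real) \<Rightarrow> bool" where
  "dag_markov_system V P s T pr r \<longleftrightarrow>
     markov_system V P s T pr r \<and> acyclic (ms_graph V P T)"

section \<open>The MPOI game\<close>

text \<open>Actions: Adv i b advances system i; the flag b is the irrevocable decision
  (keep / discard) about the previously active system when the strategy switches away from it
  (only relevant under the commitment constraint). Stop I ends the game selecting I.\<close>

datatype 'i act = Adv 'i bool | Stop "'i set"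

type_synonym ('i, 'v) hist = "('i act \<times> 'v) list"

text \<open>Current configuration (state of every system) after a history; each Adv step records the
  new state of the advanced system.\<close>
definition cfg :: "('i \<Rightarrow> 'v) \<Rightarrow> ('i, 'v) hist \<Rightarrow> 'i \<Rightarrow> 'v" where
  "cfg s h = foldl (\<lambda>c (a, v). case a of Adv i b \<Rightarrow> c(i := v) | Stop I \<Rightarrow> c) s h"

text \<open>Commitment bookkeeping: (closed systems, selected closed systems, active system).\<close>
definition book :: "('i, 'v) hist \<Rightarrow> 'i set \<times> 'i set \<times> 'i option" where
  "book h = foldl (\<lambda>(cl, sel, ac) (a, v). case a of
      Adv i b \<Rightarrow> (case ac of
          None \<Rightarrow> (cl, sel, Some i)
        | Some j \<Rightarrow> (if j = i then (cl, sel, Some i)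
                     else (insert j cl, (if b then insert j sel else sel), Some i)))
    | Stop I \<Rightarrow> (cl, sel, ac)) ({}, {}, None) h"

definition closed_set :: "('i, 'v) hist \<Rightarrow> 'i set" where "closed_set h = fst (book h)"
definition selected_set :: "('i, 'v) hist \<Rightarrow> 'i set" where "selected_set h = fst (snd (book h))"
definition active_sys :: "('i, 'v) hist \<Rightarrow> 'i option" where "active_sys h = snd (snd (book h))"

text \<open>Allowed actions. commit = False: unconstrained game; commit = True: commitment constraint.\<close>
definition allowed ::
  "bool \<Rightarrow> 'i set \<Rightarrow> 'i set set \<Rightarrow> ('i \<Rightarrow> 'v set) \<Rightarrow> ('i \<Rightarrow> 'v)
     \<Rightarrow> ('i, 'v) hist \<Rightarrow> 'i act \<Rightarrow> bool" where
  "allowed commit J F T s h a = (let c = cfg s h in case a of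
      Adv i b \<Rightarrow> i \<in> J \<and> c i \<notin> T i \<and>
        (commit \<longrightarrow> i \<notin> closed_set h \<and>
           (b \<longrightarrow> (\<exists>j. active_sys h = Some j \<and> j \<noteq> i \<and> c j \<in> T j)))
    | Stop I \<Rightarrow> I \<subseteq> J \<and> (\<forall>k \<in> I. c k \<in> T k) \<and>
        (if commit then I \<inter> closed_set h = {} \<and> selected_set h \<union> I \<in> F else I \<in> F))"

text \<open>Adaptive (randomised, history dependent) strategies.\<close>
type_synonym ('i, 'v) strategy = "('i, 'v) hist \<Rightarrow> 'i act pmf"

inductive reachable ::
  "('i \<Rightarrow> 'v \<Rightarrow> 'v pmf) \<Rightarrow> ('i \<Rightarrow> 'v) \<Rightarrow> ('i, 'v) strategy \<Rightarrow> ('i, 'v) hist \<Rightarrow> bool"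
  for P s \<sigma> where
  reach_Nil: "reachable P s \<sigma> []"
| reach_Adv: "reachable P s \<sigma> h \<Longrightarrow> Adv i b \<in> set_pmf (\<sigma> h) \<Longrightarrow>
     v \<in> set_pmf (P i (cfg s h i)) \<Longrightarrow> reachable P s \<sigma> (h @ [(Adv i b, v)])"

definition valid_strategy ::
  "bool \<Rightarrow> 'i set \<Rightarrow> 'i set set \<Rightarrow> ('i \<Rightarrow> 'v \<Rightarrow> 'v pmf) \<Rightarrow> ('i \<Rightarrow> 'v) \<Rightarrow> ('i \<Rightarrow> 'v set)
     \<Rightarrow> ('i, 'v) strategy \<Rightarrow> bool" where
  "valid_strategy commit J F P s T \<sigma> \<longleftrightarrow>
     (\<forall>h. reachable P s \<sigma> h \<longrightarrow> (\<forall>a \<in> set_pmf (\<sigma> h). allowed commit J F T s h a))"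

text \<open>Expected utility with a fuel bound n (the number of remaining steps).\<close>
fun value_fuel ::
  "bool \<Rightarrow> ('i \<Rightarrow> 'v \<Rightarrow> 'v pmf) \<Rightarrow> ('i \<Rightarrow> 'v) \<Rightarrow> ('i \<Rightarrow> 'v \<Rightarrow> real) \<Rightarrow> ('i \<Rightarrow> 'v \<Rightarrow> real)
     \<Rightarrow> ('i, 'v) strategy \<Rightarrow> nat \<Rightarrow> ('i, 'v) hist \<Rightarrow> real" where
  "value_fuel commit P s pr r \<sigma> 0 h = 0"
| "value_fuel commit P s pr r \<sigma> (Suc n) h =
     measure_pmf.expectation (\<sigma> h) (\<lambda>a. case a of
         Stop I \<Rightarrow> (\<Sum>k \<in> (if commit then selected_set h \<union> I else I). r k (cfg s h k))
       | Adv i b \<Rightarrow> - pr i (cfg s h i) +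
           measure_pmf.expectation (P i (cfg s h i))
             (\<lambda>v. value_fuel commit P s pr r \<sigma> n (h @ [(Adv i b, v)])))"

text \<open>Utility of a strategy. The fuel bound exceeds the maximal number of steps of any valid
  strategy in DAG Markov systems (each system advances at most card (V i) - 1 times, plus the
  final Stop), so it is the exact expected utility for valid strategies.\<close>
definition utility ::
  "bool \<Rightarrow> 'i set \<Rightarrow> ('i \<Rightarrow> 'v set) \<Rightarrow> ('i \<Rightarrow> 'v \<Rightarrow> 'v pmf) \<Rightarrow> ('i \<Rightarrow> 'v)
     \<Rightarrow> ('i \<Rightarrow> 'v \<Rightarrow> real) \<Rightarrow> ('i \<Rightarrow> 'v \<Rightarrow> real) \<Rightarrow> ('i, 'v) strategy \<Rightarrow> real" where
  "utility commit J V P s pr r \<sigma> =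
     value_fuel commit P s pr r \<sigma> (Suc (\<Sum>i \<in> J. card (V i))) []"

section \<open>Online contention resolution schemes\<close>

text \<open>An OCRS is given as a randomised decision rule: for x and the history of revealed
  elements (element, active?, selected?) it gives the distribution of the decision for the
  currently revealed active element. Elements are revealed in an order ord (fixed in advance,
  unknown to the scheme); each element is active independently with probability x i.\<close>
type_synonym 'i ocrs = "('i \<Rightarrow> real) \<Rightarrow> ('i \<times> bool \<times> bool) list \<Rightarrow> 'i \<Rightarrow> bool pmf"

fun ocrs_run :: "'i ocrs \<Rightarrow> ('i \<Rightarrow> real) \<Rightarrow> ('i \<times> bool \<times> bool) list \<Rightarrow> 'i list
                  \<Rightarrow> ('i \<times> bool \<times> bool) list pmf" where
  "ocrs_run \<psi> x h [] = return_pmf h"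
| "ocrs_run \<psi> x h (i # is) =
     bernoulli_pmf (x i) \<bind> (\<lambda>act.
       (if act then \<psi> x h i else return_pmf False) \<bind> (\<lambda>d.
         ocrs_run \<psi> x (h @ [(i, act, d)]) is))"

definition ocrs_active :: "('i \<times> bool \<times> bool) list \<Rightarrow> 'i set" where
  "ocrs_active h = {i. \<exists>d. (i, True, d) \<in> set h}"

definition ocrs_selected :: "('i \<times> bool \<times> bool) list \<Rightarrow> 'i set" where
  "ocrs_selected h = {i. \<exists>a. (i, a, True) \<in> set h}"

definition selectable_ocrs ::
  "'i set \<Rightarrow> 'i set set \<Rightarrow> ('i \<Rightarrow> real) set \<Rightarrow> real \<Rightarrow> 'i ocrs \<Rightarrow> bool" where
  "selectable_ocrs J F PF c \<psi> \<longleftrightarrow>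
     (\<forall>x \<in> PF. \<forall>ord. distinct ord \<and> set ord = J \<longrightarrow>
        (\<forall>h \<in> set_pmf (ocrs_run \<psi> x [] ord). ocrs_selected h \<in> F) \<and>
        (\<forall>i \<in> J. measure_pmf.prob (ocrs_run \<psi> x [] ord) {h. i \<in> ocrs_active h} > 0 \<longrightarrow>
            measure_pmf.prob (ocrs_run \<psi> x [] ord) {h. i \<in> ocrs_selected h \<and> i \<in> ocrs_active h}
            / measure_pmf.prob (ocrs_run \<psi> x [] ord) {h. i \<in> ocrs_active h} \<ge> c))"

section \<open>Packing families and relaxations\<close>

definition downward_closed_family :: "'i set \<Rightarrow> 'i set set \<Rightarrow> bool" where
  "downward_closed_family J F \<longleftrightarrow> F \<noteq> {} \<and> F \<subseteq> Pow J \<and> (\<forall>A \<in> F. \<forall>B. B \<subseteq> A \<longrightarrow> B \<in> F)"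

definition indicator_vec :: "'i set \<Rightarrow> 'i \<Rightarrow> real" where
  "indicator_vec I = (\<lambda>i. if i \<in> I then 1 else 0)"

definition convex_relaxation :: "'i set \<Rightarrow> 'i set set \<Rightarrow> ('i \<Rightarrow> real) set \<Rightarrow> bool" where
  "convex_relaxation J F PF \<longleftrightarrow>
     (\<forall>x \<in> PF. \<forall>i. (i \<in> J \<longrightarrow> 0 \<le> x i \<and> x i \<le> 1) \<and> (i \<notin> J \<longrightarrow> x i = 0)) \<and>
     (\<forall>x \<in> PF. \<forall>y \<in> PF. \<forall>t::real. 0 \<le> t \<and> t \<le> 1 \<longrightarrow> (\<lambda>i. t * x i + (1 - t) * y i) \<in> PF) \<and>
     (\<forall>I \<in> F. indicator_vec I \<in> PF)"

end

theory Submission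
  imports Defs
begin

text \<open>
  Let \<open>x i\<close> be the probability that an unconstrained strategy selects \<open>i\<close>, and \<open>u i\<close> the expected
  value of \<open>i\<close> minus the prices paid for it. Then \<open>x\<close> is a mixture of indicator vectors, so
  it lies in the relaxation; the utility is the sum of the \<open>u i\<close>; and, simulating all other
  systems, each system has a stand-alone policy with selection probability \<open>x i\<close> and net value \<open>u i\<close>.
  The answer of an OCRS about \<open>i\<close> does not depend on whether \<open>i\<close> is active, so it may be asked
  for before touching system \<open>i\<close>. If the answer is no, system \<open>i\<close> is skipped at no cost and its
  activity is faked by a coin; if it is yes, the stand-alone policy is run and \<open>i\<close> counts as active iff
  that policy selects it. Thus \<open>u i\<close> is collected with probability at least \<open>1/\<alpha>\<close>.

  This committed policy uses private randomness that is not recorded in the history. Instead of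
  converting it to a history-dependent strategy, it is only compared with the value of the
  committed game computed by backward induction, which is attained by a deterministic strategy that depends on
  none of the above data; this also gives a single strategy good against all competitors.
\<close>

section \<open>Expectations over finitely supported distributions\<close>

lemma expectation_mono_finite:
  fixes f g :: "'a \<Rightarrow> real"
  assumes "finite (set_pmf D)" "\<And>a. a \<in> set_pmf D \<Longrightarrow> f a \<le> g a"
  shows "measure_pmf.expectation D f \<le> measure_pmf.expectation D g"
  using assms by (intro integral_mono_AE) (auto intro: integrable_measure_pmf_finite simp: AE_measure_pmf_iff)

lemma expectation_cong_pmf:
  fixes f g :: "'a \<Rightarrow> real"
  assumes "\<And>a. a \<in> set_pmf D \<Longrightarrow> f a = g a"
  shows "measure_pmf.expectation D f = measure_pmf.expectation D g"
  using assms by (intro integral_cong_AE) (auto simp: AE_measure_pmf_iff)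

lemma expectation_bool_pmf:
  fixes f :: "bool \<Rightarrow> real"
  shows "measure_pmf.expectation D f = pmf D True * f True + (1 - pmf D True) * f False"
proof -
  have "measure_pmf.expectation D f = (\<Sum>b\<in>UNIV. pmf D b * f b)"
    by (subst integral_measure_pmf[of UNIV]) auto
  then show ?thesis
    by (simp add: UNIV_bool pmf_False_conv_True)
qed

text \<open>Peel off the weight \<open>t\<close> of one point and rescale the others by
  \<open>1 - t\<close>, which is nonzero because all weights are positive. The index type is free:
  it serves both for the relaxation and, with two indices, for pairs of numbers.\<close>

lemma mixture_closed_sum:
  fixes K :: "('k \<Rightarrow> real) set"
  assumes mix: "\<And>x y t. x \<in> K \<Longrightarrow> y \<in> K \<Longrightarrow> 0 \<le> t \<Longrightarrow> t \<le> 1 \<Longrightarrow> (\<lambda>k. t * x k + (1 - t) * y k) \<in> K"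
    and "finite A" "A \<noteq> {}"
  shows "(\<And>a. a \<in> A \<Longrightarrow> 0 < c a) \<Longrightarrow> (\<Sum>a\<in>A. c a) = 1 \<Longrightarrow> (\<And>a. a \<in> A \<Longrightarrow> f a \<in> K)
     \<Longrightarrow> (\<lambda>k. \<Sum>a\<in>A. c a * f a k) \<in> K"
  using assms(2,3)
proof (induction A arbitrary: c rule: finite_ne_induct)
  case (singleton a)
  then show ?case by simp
next
  case (insert a A)
  define t where "t = c a"
  have pos: "0 < (\<Sum>b\<in>A. c b)"
    using insert.prems(1) insert.hyps by (intro sum_pos) auto
  have t: "0 < t" "t < 1" "(\<Sum>b\<in>A. c b) = 1 - t"
    using insert.prems(1,2) insert.hyps pos by (auto simp: t_def)
  have "(\<lambda>k. \<Sum>b\<in>A. (c b / (1 - t)) * f b k) \<in> K"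
    using insert.prems t by (intro insert.IH) (auto simp flip: sum_divide_distrib)
  then have "(\<lambda>k. t * f a k + (1 - t) * (\<Sum>b\<in>A. (c b / (1 - t)) * f b k)) \<in> K"
    using insert.prems(3) t by (intro mix) auto
  also have "(\<lambda>k. t * f a k + (1 - t) * (\<Sum>b\<in>A. (c b / (1 - t)) * f b k))
      = (\<lambda>k. \<Sum>b\<in>insert a A. c b * f b k)"
    using t insert.hyps by (auto simp: sum_distrib_left t_def)
  finally show ?case .
qed

lemma mixture_closed_expectation:
  fixes K :: "('k \<Rightarrow> real) set"
  assumes mix: "\<And>x y t. x \<in> K \<Longrightarrow> y \<in> K \<Longrightarrow> 0 \<le> t \<Longrightarrow> t \<le> 1 \<Longrightarrow> (\<lambda>k. t * x k + (1 - t) * y k) \<in> K"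
    and fin: "finite (set_pmf D)"
    and f: "\<And>a. a \<in> set_pmf D \<Longrightarrow> f a \<in> K"
  shows "(\<lambda>k. measure_pmf.expectation D (\<lambda>a. f a k)) \<in> K"
proof -
  have "(\<lambda>k. \<Sum>a\<in>set_pmf D. pmf D a * f a k) \<in> K"
    using fin f by (intro mixture_closed_sum mix)
      (auto simp: set_pmf_not_empty pmf_positive sum_pmf_eq_1)
  then show ?thesis
    using fin by (subst integral_measure_pmf[of "set_pmf D"]) (auto simp: set_pmf_eq)
qed

section \<open>Stand-alone policies for a single system\<close>

text \<open>\<open>achievable P T pr r v p q\<close>: from state \<open>v\<close>, some randomised policy selects with
  probability \<open>p\<close> and has expected value minus price \<open>q\<close>.\<close>

inductive achievable ::
  "('v \<Rightarrow> 'v pmf) \<Rightarrow> 'v set \<Rightarrow> ('v \<Rightarrow> real) \<Rightarrow> ('v \<Rightarrow> real) \<Rightarrow> 'v \<Rightarrow> real \<Rightarrow> real \<Rightarrow> bool"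
  for P T pr r where
  discard: "achievable P T pr r v 0 0"
| select: "v \<in> T \<Longrightarrow> achievable P T pr r v 1 (r v)"
| advance: "v \<notin> T \<Longrightarrow> (\<And>w. w \<in> set_pmf (P v) \<Longrightarrow> achievable P T pr r w (f w) (g w)) \<Longrightarrow>
    achievable P T pr r v (measure_pmf.expectation (P v) f) (- pr v + measure_pmf.expectation (P v) g)"
| mix: "achievable P T pr r v p q \<Longrightarrow> achievable P T pr r v p' q' \<Longrightarrow> 0 \<le> t \<Longrightarrow> t \<le> 1 \<Longrightarrow>
    achievable P T pr r v (t * p + (1 - t) * p') (t * q + (1 - t) * q')"

lemma achievable_expectation:
  assumes "finite (set_pmf D)" "\<And>a. a \<in> set_pmf D \<Longrightarrow> achievable P T pr r v (f a) (g a)"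
  shows "achievable P T pr r v (measure_pmf.expectation D f) (measure_pmf.expectation D g)"
proof -
  \<comment> \<open>A pair of numbers is coded as a function on \<open>bool\<close>, so that closure
    under \<open>mix\<close> becomes closure of a set of functions under mixtures.\<close>
  define K where "K = {z. achievable P T pr r v (z True) (z False)}"
  have "(\<lambda>k. measure_pmf.expectation D (\<lambda>a. if k then f a else g a)) \<in> K"
    by (rule mixture_closed_expectation) (use assms in \<open>auto simp: K_def intro: mix\<close>)
  then show ?thesis
    by (simp add: K_def)
qed

lemma markov_system_finite_support:
  assumes "markov_system V P s T pr r" "v \<in> V" "v \<notin> T"
  shows "finite (set_pmf (P v))" "set_pmf (P v) \<subseteq> V"
  using assms by (auto simp: markov_system_def intro: finite_subset)

text \<open>Only selections earn, at most \<open>M\<close> each, and prices only subtract. The case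
  \<open>p = 0\<close> matters later: a system that is never selected has no positive net
  value.\<close>

lemma achievable_bound:
  assumes "achievable P T pr r v p q"
    and ms: "markov_system V P s T pr r"
    and M: "\<And>t. t \<in> T \<Longrightarrow> r t \<le> M"
    and "v \<in> V"
  shows "q \<le> M * p"
  using assms(1,4)
proof induction
  case (advance v f g)
  note fin = markov_system_finite_support[OF ms advance.prems advance.hyps(1)]
  have "measure_pmf.expectation (P v) g \<le> measure_pmf.expectation (P v) (\<lambda>w. M * f w)"
    using fin advance.IH by (intro expectation_mono_finite) auto
  moreover have "pr v \<ge> 0"
    using ms advance.prems advance.hyps(1) by (auto simp: markov_system_def)
  ultimately show ?case by simp
next
  case (mix v p q p' q' t)
  then have "t * q \<le> t * (M * p)" "(1 - t) * q' \<le> (1 - t) * (M * p')"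
    by (auto intro: mult_left_mono)
  then show ?case by (simp add: algebra_simps)
qed (use M in auto)

section \<open>A rank that bounds the number of moves left in a DAG system\<close>

definition rank :: "'v set \<Rightarrow> ('v \<Rightarrow> 'v pmf) \<Rightarrow> 'v set \<Rightarrow> 'v \<Rightarrow> nat" where
  "rank V P T v = card {w. (v, w) \<in> (ms_graph V P T)\<^sup>+}"

lemma descendants_subset:
  assumes "markov_system V P s T pr r"
  shows "{w. (v, w) \<in> (ms_graph V P T)\<^sup>+} \<subseteq> V"
proof
  fix w assume "w \<in> {w. (v, w) \<in> (ms_graph V P T)\<^sup>+}"
  then have "(v, w) \<in> (ms_graph V P T)\<^sup>+" by simp
  then show "w \<in> V"
    using assms by cases (auto simp: ms_graph_def markov_system_def)
qed

lemma rank_le_card: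
  assumes "markov_system V P s T pr r"
  shows "rank V P T v \<le> card V"
  unfolding rank_def using assms descendants_subset[OF assms]
  by (intro card_mono) (auto simp: markov_system_def)

text \<open>The descendants of \<open>w\<close> are descendants of \<open>v\<close>;
  \<open>w\<close> itself is one of \<open>v\<close> but, by acyclicity, not one of its own.\<close>

lemma rank_decreases:
  assumes "dag_markov_system V P s T pr r" "v \<in> V" "v \<notin> T" "w \<in> set_pmf (P v)"
  shows "rank V P T w < rank V P T v"
proof -
  have ms: "markov_system V P s T pr r" and ac: "acyclic (ms_graph V P T)"
    using assms(1) by (auto simp: dag_markov_system_def)
  have e: "(v, w) \<in> ms_graph V P T"
    using assms by (auto simp: ms_graph_def)
  have "{u. (w, u) \<in> (ms_graph V P T)\<^sup>+} \<subset> {u. (v, u) \<in> (ms_graph V P T)\<^sup>+}"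
    using e ac by (auto simp: acyclic_def intro: trancl_into_trancl2)
  moreover have "finite {u. (v, u) \<in> (ms_graph V P T)\<^sup>+}"
    by (rule finite_subset[OF descendants_subset[OF ms]]) (use ms in \<open>simp add: markov_system_def\<close>)
  ultimately show ?thesis
    unfolding rank_def by (intro psubset_card_mono)
qed

section \<open>Bookkeeping of the game\<close>

lemma cfg_Nil [simp]: "cfg s [] = s"
  by (simp add: cfg_def)

lemma cfg_Adv [simp]: "cfg s (h @ [(Adv i b, v)]) = (cfg s h)(i := v)"
  by (simp add: cfg_def)

lemma book_Nil [simp]:
  "closed_set [] = {}" "selected_set [] = {}" "active_sys [] = None"
  by (simp_all add: closed_set_def selected_set_def active_sys_def book_def)

lemma book_Adv:
  "closed_set (h @ [(Adv i b, v)]) = closed_set h \<union> (set_option (active_sys h) - {i})"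
  "selected_set (h @ [(Adv i b, v)]) =
     (if b then selected_set h \<union> (set_option (active_sys h) - {i}) else selected_set h)"
  "active_sys (h @ [(Adv i b, v)]) = Some i"
  by (auto simp: closed_set_def selected_set_def active_sys_def book_def
      split: option.splits prod.splits if_splits)

lemma selected_set_Stop [simp]: "selected_set (h @ [(Stop I, v)]) = selected_set h"
  by (auto simp: selected_set_def book_def split: prod.splits)

definition touched :: "('i, 'v) hist \<Rightarrow> 'i set" where
  "touched h = closed_set h \<union> set_option (active_sys h)"

locale mpoi_game =
  fixes J :: "'i set" and F :: "'i set set"
    and V :: "'i \<Rightarrow> 'v set" and P :: "'i \<Rightarrow> 'v \<Rightarrow> 'v pmf" and s :: "'i \<Rightarrow> 'v"
    and T :: "'i \<Rightarrow> 'v set" and pr :: "'i \<Rightarrow> 'v \<Rightarrow> real" and r :: "'i \<Rightarrow> 'v \<Rightarrow> real"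
  assumes finite_J: "finite J"
    and downward_closed: "downward_closed_family J F"
    and dag: "\<And>i. i \<in> J \<Longrightarrow> dag_markov_system (V i) (P i) (s i) (T i) (pr i) (r i)"
begin

lemma system: "i \<in> J \<Longrightarrow> markov_system (V i) (P i) (s i) (T i) (pr i) (r i)"
  using dag by (auto simp: dag_markov_system_def)

lemma F_subset_closed: "A \<in> F \<Longrightarrow> B \<subseteq> A \<Longrightarrow> B \<in> F"
  using downward_closed by (auto simp: downward_closed_family_def)

lemma empty_in_F: "{} \<in> F"
  using downward_closed by (auto simp: downward_closed_family_def)

lemma F_subset_J: "A \<in> F \<Longrightarrow> A \<subseteq> J"
  using downward_closed by (auto simp: downward_closed_family_def)

text \<open>Legality thus forces finite supports, so that expectations commute with finite sums, and
  optimal play becomes a maximum over finitely many actions.\<close>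

lemma allowed_finite: "finite {a. allowed commit J F T s h a}"
proof (rule finite_subset)
  show "{a. allowed commit J F T s h a} \<subseteq> (\<lambda>(i, b). Adv i b) ` (J \<times> UNIV) \<union> Stop ` Pow J"
  proof
    fix a assume "a \<in> {a. allowed commit J F T s h a}"
    then show "a \<in> (\<lambda>(i, b). Adv i b) ` (J \<times> UNIV) \<union> Stop ` Pow J"
      by (cases a) (auto simp: allowed_def Let_def image_iff split: if_splits)
  qed
qed (use finite_J in auto)

lemma reachable_in_V:
  assumes "reachable P s \<sigma> h" "valid_strategy commit J F P s T \<sigma>" "i \<in> J"
  shows "cfg s h i \<in> V i"
  using assms
proof (induction arbitrary: i)
  case reach_Nil
  then show ?case using system by (auto simp: markov_system_def)
next
  case (reach_Adv h j b v)
  have "allowed commit J F T s h (Adv j b)"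
    using reach_Adv by (auto simp: valid_strategy_def)
  then have "j \<in> J" "cfg s h j \<notin> T j"
    by (auto simp: allowed_def Let_def)
  then show ?case
    using reach_Adv markov_system_finite_support(2)[OF system, of j "cfg s h j"] by auto
qed

section \<open>Decomposing an unconstrained strategy\<close>

text \<open>With \<open>pr\<close> and \<open>r\<close> this is the net contribution of system
  \<open>i\<close> to the utility; with costs 0 and rewards 1 it is the probability that
  \<open>i\<close> is selected. Both follow the recursion of \<open>value_fuel\<close>, including
  the 0 when the fuel runs out.\<close>

primrec share ::
  "('i \<Rightarrow> 'v \<Rightarrow> real) \<Rightarrow> ('i \<Rightarrow> 'v \<Rightarrow> real) \<Rightarrow> ('i, 'v) strategy \<Rightarrow> nat \<Rightarrow> ('i, 'v) hist \<Rightarrow> 'i \<Rightarrow> real" where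
  "share c w \<sigma> 0 = (\<lambda>h i. 0)"
| "share c w \<sigma> (Suc n) = (\<lambda>h i. measure_pmf.expectation (\<sigma> h) (\<lambda>a. case a of
       Stop I \<Rightarrow> (if i \<in> I then w i (cfg s h i) else 0)
     | Adv j b \<Rightarrow> (if j = i then - c i (cfg s h i) else 0) +
         measure_pmf.expectation (P j (cfg s h j)) (\<lambda>v. share c w \<sigma> n (h @ [(Adv j b, v)]) i)))"

abbreviation sel_prob :: "('i, 'v) strategy \<Rightarrow> nat \<Rightarrow> ('i, 'v) hist \<Rightarrow> 'i \<Rightarrow> real" where
  "sel_prob \<equiv> share (\<lambda>_ _. 0) (\<lambda>_ _. 1)"

lemma unconstrained_step:
  assumes "valid_strategy False J F P s T \<sigma>" "reachable P s \<sigma> h"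
  shows "finite (set_pmf (\<sigma> h))"
    and "Stop I \<in> set_pmf (\<sigma> h) \<Longrightarrow> I \<in> F \<and> (\<forall>k\<in>I. cfg s h k \<in> T k)"
    and "Adv j b \<in> set_pmf (\<sigma> h) \<Longrightarrow> j \<in> J \<and> cfg s h j \<notin> T j \<and> finite (set_pmf (P j (cfg s h j)))"
proof -
  have al: "\<And>a. a \<in> set_pmf (\<sigma> h) \<Longrightarrow> allowed False J F T s h a"
    using assms by (auto simp: valid_strategy_def)
  show "finite (set_pmf (\<sigma> h))"
    by (rule finite_subset[OF _ allowed_finite[of False h]]) (use al in auto)
  show "Stop I \<in> set_pmf (\<sigma> h) \<Longrightarrow> I \<in> F \<and> (\<forall>k\<in>I. cfg s h k \<in> T k)"
    using al by (force simp: allowed_def Let_def)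
  assume "Adv j b \<in> set_pmf (\<sigma> h)"
  then have "j \<in> J" "cfg s h j \<notin> T j"
    using al by (force simp: allowed_def Let_def)+
  then show "j \<in> J \<and> cfg s h j \<notin> T j \<and> finite (set_pmf (P j (cfg s h j)))"
    using markov_system_finite_support(1)[OF system, of j "cfg s h j"] reachable_in_V[OF assms(2,1)]
    by auto
qed

text \<open>Linearity of expectation: each price is charged to the system advanced, each value to
  the element selected.\<close>

lemma value_fuel_eq_sum_share:
  assumes "valid_strategy False J F P s T \<sigma>" "reachable P s \<sigma> h"
  shows "value_fuel False P s pr r \<sigma> n h = (\<Sum>i\<in>J. share pr r \<sigma> n h i)"
  using assms(2)
proof (induction n arbitrary: h)
  case (Suc n)
  note step = unconstrained_step[OF assms(1) Suc.prems]
  have "(\<Sum>i\<in>J. share pr r \<sigma> (Suc n) h i) = measure_pmf.expectation (\<sigma> h) (\<lambda>a. \<Sum>i\<in>J. case a of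
       Stop I \<Rightarrow> (if i \<in> I then r i (cfg s h i) else 0)
     | Adv j b \<Rightarrow> (if j = i then - pr i (cfg s h i) else 0) +
         measure_pmf.expectation (P j (cfg s h j)) (\<lambda>v. share pr r \<sigma> n (h @ [(Adv j b, v)]) i))"
    using step(1) by (simp add: Bochner_Integration.integral_sum integrable_measure_pmf_finite)
  also have "\<dots> = value_fuel False P s pr r \<sigma> (Suc n) h"
    unfolding value_fuel.simps
  proof (rule expectation_cong_pmf, goal_cases)
    case (1 a)
    show ?case
    proof (cases a)
      case (Stop I)
      then have "I \<subseteq> J" using 1 step(2) F_subset_J by blast
      then have "J \<inter> I = I" by blast
      then show ?thesis
        using Stop finite_J by (simp add: sum.inter_restrict[symmetric])
    next
      case (Adv j b)
      then have j: "j \<in> J" "finite (set_pmf (P j (cfg s h j)))"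
        using 1 step(3) by auto
      have "(\<Sum>i\<in>J. measure_pmf.expectation (P j (cfg s h j)) (\<lambda>v. share pr r \<sigma> n (h @ [(Adv j b, v)]) i))
        = measure_pmf.expectation (P j (cfg s h j)) (\<lambda>v. \<Sum>i\<in>J. share pr r \<sigma> n (h @ [(Adv j b, v)]) i)"
        using j by (subst Bochner_Integration.integral_sum) (auto simp: integrable_measure_pmf_finite)
      also have "\<dots> = measure_pmf.expectation (P j (cfg s h j))
          (\<lambda>v. value_fuel False P s pr r \<sigma> n (h @ [(Adv j b, v)]))"
        using 1 Adv Suc.prems by (intro expectation_cong_pmf Suc.IH[symmetric] reach_Adv) auto
      finally show ?thesis
        using Adv j finite_J by (simp add: sum.distrib sum.delta')
    qed
  qed
  finally show ?case by simp
qed simp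

text \<open>A run ends in the indicator vector of a feasible set, where running out of fuel counts
  as selecting the empty set; averaging over actions and moves stays in the convex set.\<close>

lemma sel_prob_in_relaxation:
  assumes "valid_strategy False J F P s T \<sigma>" "reachable P s \<sigma> h" "convex_relaxation J F PF"
  shows "sel_prob \<sigma> n h \<in> PF"
  using assms(2)
proof (induction n arbitrary: h)
  case 0
  have "indicator_vec {} \<in> PF"
    using assms(3) empty_in_F by (auto simp: convex_relaxation_def)
  then show ?case by (simp add: indicator_vec_def)
next
  case (Suc n)
  note step = unconstrained_step[OF assms(1) Suc.prems]
  have mix: "\<And>x y t. x \<in> PF \<Longrightarrow> y \<in> PF \<Longrightarrow> 0 \<le> t \<Longrightarrow> t \<le> 1 \<Longrightarrow> (\<lambda>k. t * x k + (1 - t) * y k) \<in> PF"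
    using assms(3) by (auto simp: convex_relaxation_def)
  show ?case
    unfolding share.simps
  proof (rule mixture_closed_expectation[OF mix step(1)], goal_cases)
    case (5 a)
    show ?case
    proof (cases a)
      case (Stop I)
      then have "I \<in> F" using 5 step(2) by blast
      then have "indicator_vec I \<in> PF"
        using assms(3) by (auto simp: convex_relaxation_def)
      then show ?thesis using Stop by (simp add: indicator_vec_def)
    next
      case (Adv j b)
      then have "(\<lambda>i. measure_pmf.expectation (P j (cfg s h j)) (\<lambda>v. sel_prob \<sigma> n (h @ [(Adv j b, v)]) i)) \<in> PF"
        using 5 Suc step(3) by (intro mixture_closed_expectation[OF mix]) (auto intro: reach_Adv)
      moreover have "(\<lambda>k. (if j = k then - 0 else 0) + measure_pmf.expectation (P j (cfg s h j))
            (\<lambda>v. sel_prob \<sigma> n (h @ [(Adv j b, v)]) k))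
          = (\<lambda>i. measure_pmf.expectation (P j (cfg s h j)) (\<lambda>v. sel_prob \<sigma> n (h @ [(Adv j b, v)]) i))"
        by auto
      ultimately show ?thesis using Adv by simp
    qed
  qed auto
qed

text \<open>The history-dependent strategy becomes a policy for system \<open>i\<close> alone: moves of the other
  systems act as mixtures.\<close>

lemma share_achievable:
  assumes "valid_strategy False J F P s T \<sigma>" "reachable P s \<sigma> h"
  shows "achievable (P i) (T i) (pr i) (r i) (cfg s h i) (sel_prob \<sigma> n h i) (share pr r \<sigma> n h i)"
  using assms(2)
proof (induction n arbitrary: h)
  case 0
  show ?case by (simp add: discard)
next
  case (Suc n)
  note step = unconstrained_step[OF assms(1) Suc.prems]
  show ?case
    unfolding share.simps
  proof (rule achievable_expectation[OF step(1)], goal_cases)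
    case (1 a)
    show ?case
    proof (cases a)
      case (Stop I)
      then show ?thesis
        using 1 step(2) by (auto intro: discard select)
    next
      case (Adv j b)
      have j: "cfg s h j \<notin> T j" "finite (set_pmf (P j (cfg s h j)))"
        using 1 Adv step(3) by auto
      have IH: "achievable (P i) (T i) (pr i) (r i) (cfg s (h @ [(Adv j b, v)]) i)
          (sel_prob \<sigma> n (h @ [(Adv j b, v)]) i) (share pr r \<sigma> n (h @ [(Adv j b, v)]) i)"
        if "v \<in> set_pmf (P j (cfg s h j))" for v
        using that 1 Adv Suc.prems by (intro Suc.IH) (auto intro: reach_Adv)
      show ?thesis
      proof (cases "j = i")
        case True
        then show ?thesis
          using Adv j IH advance[of "cfg s h i" "T i" "P i"] by auto
      next
        case False
        then show ?thesis
          using Adv j IH by (auto intro!: achievable_expectation)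
      qed
    qed
  qed
qed

section \<open>Backward induction for the game with commitment\<close>

text \<open>\<open>allowed\<close> lets the player commit to a set outside \<open>F\<close> and then have no legal action left, so
  safe actions must in addition keep the committed set in \<open>F\<close>.\<close>

definition safe :: "('i, 'v) hist \<Rightarrow> 'i act set" where
  "safe h = {a. allowed True J F T s h a \<and> (\<forall>v. selected_set (h @ [(a, v)]) \<in> F)}"

definition act_value :: "(('i, 'v) hist \<Rightarrow> real) \<Rightarrow> ('i, 'v) hist \<Rightarrow> 'i act \<Rightarrow> real" where
  "act_value w h a = (case a of
       Stop I \<Rightarrow> (\<Sum>k \<in> selected_set h \<union> I. r k (cfg s h k))
     | Adv i b \<Rightarrow> - pr i (cfg s h i) +
         measure_pmf.expectation (P i (cfg s h i)) (\<lambda>v. w (h @ [(Adv i b, v)])))"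

primrec opt :: "nat \<Rightarrow> ('i, 'v) hist \<Rightarrow> real" where
  "opt 0 = (\<lambda>h. 0)"
| "opt (Suc n) = (\<lambda>h. Max (act_value (opt n) h ` safe h))"

lemma safe_finite: "finite (safe h)"
  by (rule finite_subset[OF _ allowed_finite[of True h]]) (auto simp: safe_def)

text \<open>Stopping with no further selection is always safe, so the maximum in \<open>opt\<close>
  is taken over a nonempty set.\<close>

lemma safe_nonempty: "selected_set h \<in> F \<Longrightarrow> safe h \<noteq> {}"
  by (auto simp: safe_def allowed_def Let_def intro!: exI[of _ "Stop {}"])

lemma opt_ge: "a \<in> safe h \<Longrightarrow> act_value (opt n) h a \<le> opt (Suc n) h"
  using safe_finite by simp

lemma opt_attained:
  obtains \<sigma> where "valid_strategy True J F P s T \<sigma>"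
    and "value_fuel True P s pr r \<sigma> N [] = opt N []"
proof -
  \<comment> \<open>A strategy sees only the history, so the fuel left after the next action is read
    off its length. Beyond length \<open>N\<close> it is 0, and a safe action is still chosen, since
    validity concerns every reachable history.\<close>
  define best where "best h a \<longleftrightarrow> a \<in> safe h \<and> act_value (opt (N - Suc (length h))) h a
      = opt (Suc (N - Suc (length h))) h" for h a
  define \<sigma> where "\<sigma> h = return_pmf (SOME a. best h a)" for h
  have best: "best h (SOME a. best h a)" if "selected_set h \<in> F" for h
  proof -
    have "opt (Suc (N - Suc (length h))) h \<in> act_value (opt (N - Suc (length h))) h ` safe h"
      using Max_in[of "act_value (opt (N - Suc (length h))) h ` safe h"]
        safe_finite safe_nonempty[OF that] by simp
    then have "\<exists>a. best h a"
      by (auto simp: best_def)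
    then show ?thesis by (rule someI_ex)
  qed
  \<comment> \<open>Safe actions keep the committed set feasible, which in turn provides the next
    safe action.\<close>
  have sel: "selected_set h \<in> F" if "reachable P s \<sigma> h" for h
    using that
  proof induction
    case reach_Nil
    then show ?case by (simp add: empty_in_F)
  next
    case (reach_Adv h i b v)
    then have "Adv i b \<in> safe h"
      using best[of h] by (auto simp: \<sigma>_def best_def)
    then show ?case by (auto simp: safe_def)
  qed
  have valid: "valid_strategy True J F P s T \<sigma>"
    using sel best by (auto simp: valid_strategy_def \<sigma>_def best_def safe_def)
  have "value_fuel True P s pr r \<sigma> n h = opt n h" if "reachable P s \<sigma> h" "n + length h = N" for n h
    using that
  proof (induction n arbitrary: h)
    case (Suc n)
    define a where "a = (SOME a. best h a)"
    have a: "\<sigma> h = return_pmf a" by (simp add: \<sigma>_def a_def)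
    have n: "N - Suc (length h) = n" using Suc.prems by auto
    have "value_fuel True P s pr r \<sigma> (Suc n) h = act_value (value_fuel True P s pr r \<sigma> n) h a"
      by (simp add: a act_value_def split: act.split)
    also have "\<dots> = act_value (opt n) h a"
      using Suc a
      by (auto simp: act_value_def split: act.splits intro!: expectation_cong_pmf Suc.IH reach_Adv)
    also have "\<dots> = opt (Suc n) h"
      using best[OF sel[OF Suc.prems(1)]] n by (simp add: best_def a_def)
    finally show ?case .
  qed simp
  then show thesis
    using valid that[of \<sigma>] by (simp add: reach_Nil)
qed

text \<open>\<open>D\<close> collects the ready systems that are to be selected but whose commitment is still due,
  either at the next switch or at the end of the game. A system that starts in a destination is
  never active, so \<open>D\<close> may have several elements.\<close>

definition promised :: "('i, 'v) hist \<Rightarrow> 'i set \<Rightarrow> 'i set \<Rightarrow> bool" where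
  "promised h D S \<longleftrightarrow> S = selected_set h \<union> D \<and> S \<in> F \<and> D \<inter> closed_set h = {}
     \<and> (\<forall>k\<in>D. cfg s h k \<in> T k)"

text \<open>\<open>Stop D\<close> redeems all promises at once, at the cost of one unit of
  fuel.\<close>

lemma opt_ge_promised:
  assumes "promised h D S" "0 < n"
  shows "(\<Sum>k\<in>S. r k (cfg s h k)) \<le> opt n h"
proof -
  obtain m where m: "n = Suc m" using assms by (cases n) auto
  have "S \<subseteq> J" using F_subset_J assms by (auto simp: promised_def)
  moreover have "selected_set h \<in> F" using assms F_subset_closed by (auto simp: promised_def)
  ultimately have "Stop D \<in> safe h"
    using assms by (auto simp: safe_def allowed_def Let_def promised_def)
  from opt_ge[OF this, of m] show ?thesis
    using assms m by (simp add: act_value_def promised_def)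
qed

lemma promised_advance:
  assumes "promised h D S" "i \<in> J" "cfg s h i \<notin> T i" "i \<notin> closed_set h" "i \<notin> S"
  obtains b D' where "Adv i b \<in> safe h"
    and "\<And>w. promised (h @ [(Adv i b, w)]) D' S"
    and "\<And>w. i \<notin> closed_set (h @ [(Adv i b, w)])"
    and "\<And>w. touched (h @ [(Adv i b, w)]) = insert i (touched h)"
proof -
  \<comment> \<open>The flag redeems the promise about the system being left, which then moves from
    \<open>D\<close> to the selected set. If \<open>i\<close> itself is active, it is not in
    \<open>D\<close>, so \<open>b\<close> is false as legality demands.\<close>
  define b where "b \<longleftrightarrow> (\<exists>j. active_sys h = Some j \<and> j \<in> D)"
  define D' where "D' = D - set_option (active_sys h)"
  have D: "i \<notin> D" using assms by (auto simp: promised_def)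
  have p: "promised (h @ [(Adv i b, w)]) D' S" for w
    using assms D
    by (cases "active_sys h") (auto simp: promised_def D'_def b_def book_Adv)
  have "selected_set (h @ [(Adv i b, w)]) \<in> F" for w
    using p[of w] F_subset_closed by (auto simp: promised_def)
  then have "Adv i b \<in> safe h"
    using assms D by (auto simp: safe_def allowed_def Let_def b_def promised_def)
  moreover have "i \<notin> closed_set (h @ [(Adv i b, w)])" for w
    using assms by (auto simp: book_Adv)
  moreover have "touched (h @ [(Adv i b, w)]) = insert i (touched h)" for w
    by (auto simp: touched_def book_Adv)
  ultimately show thesis using p that by blast
qed

text \<open>Playing a stand-alone policy for system \<open>i\<close>, when continuing after a selection is worth \<open>LT\<close>
  and continuing after a discard is worth \<open>LF\<close>.\<close>

lemma opt_ge_achievable: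
  fixes base LT LF :: real
  assumes "achievable (P i) (T i) (pr i) (r i) v p q"
    and i: "i \<in> J" "i \<notin> S" "insert i S \<in> F"
    and KT: "\<And>h D n. m \<le> n \<Longrightarrow> promised h D (insert i S) \<Longrightarrow> cfg s h i \<in> T i \<Longrightarrow>
        touched h \<subseteq> insert i U \<Longrightarrow> (\<forall>k. k \<noteq> i \<longrightarrow> cfg s h k = c k) \<Longrightarrow>
        base + r i (cfg s h i) + LT \<le> opt n h"
    and KF: "\<And>h D n. m \<le> n \<Longrightarrow> promised h D S \<Longrightarrow>
        touched h \<subseteq> insert i U \<Longrightarrow> (\<forall>k. k \<noteq> i \<longrightarrow> cfg s h k = c k) \<Longrightarrow>
        base + LF \<le> opt n h"
    and "promised h D S" "i \<notin> closed_set h" "touched h \<subseteq> insert i U"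
    and "\<forall>k. k \<noteq> i \<longrightarrow> cfg s h k = c k" "cfg s h i = v" "v \<in> V i"
    and "m + rank (V i) (P i) (T i) v \<le> n"
  shows "base + q + p * LT + (1 - p) * LF \<le> opt n h"
  using assms(1,7-13)
proof (induction arbitrary: h D n)
  case (discard v)
  then show ?case using KF[of n h D] by simp
next
  case (select v)
  \<comment> \<open>Selecting is only a promise: it takes no action and no fuel.\<close>
  have "promised h (insert i D) (insert i S)"
    using select i by (auto simp: promised_def)
  then show ?case using KT[of n h "insert i D"] select by simp
next
  case (advance v f g)
  note fin = markov_system_finite_support[OF system[OF i(1)] advance.prems(6) advance.hyps(1)]
  \<comment> \<open>A non-destination state has a successor of smaller rank, so a unit of fuel is
    left for the advance.\<close>
  obtain w0 where "w0 \<in> set_pmf (P i v)"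
    using set_pmf_not_empty by fast
  then have "rank (V i) (P i) (T i) v > 0"
    using rank_decreases[OF dag[OF i(1)] advance.prems(6) advance.hyps(1)] by fastforce
  then obtain n' where n': "n = Suc n'"
    using advance.prems by (cases n) auto
  obtain b D' where b: "Adv i b \<in> safe h"
    and D': "\<And>w. promised (h @ [(Adv i b, w)]) D' S"
    and cl: "\<And>w. i \<notin> closed_set (h @ [(Adv i b, w)])"
    and to: "\<And>w. touched (h @ [(Adv i b, w)]) = insert i (touched h)"
    using promised_advance[of h D S i] advance.prems advance.hyps i by metis
  have IH: "base + g w + f w * LT + (1 - f w) * LF \<le> opt n' (h @ [(Adv i b, w)])"
    if w: "w \<in> set_pmf (P i v)" for w
  proof (rule advance.IH[OF w D' cl])
    show "m + rank (V i) (P i) (T i) w \<le> n'"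
      using rank_decreases[OF dag[OF i(1)] advance.prems(6) advance.hyps(1) w] advance.prems n' by auto
  qed (use w to fin advance.prems in auto)
  have int: "integrable (measure_pmf (P i v)) z" for z :: "'v \<Rightarrow> real"
    using fin by (intro integrable_measure_pmf_finite)
  have "base + measure_pmf.expectation (P i v) g + measure_pmf.expectation (P i v) f * LT
        + (1 - measure_pmf.expectation (P i v) f) * LF
      = measure_pmf.expectation (P i v) (\<lambda>w. base + g w + f w * LT + (1 - f w) * LF)"
    by (simp add: int left_diff_distrib)
  also have "\<dots> \<le> measure_pmf.expectation (P i v) (\<lambda>w. opt n' (h @ [(Adv i b, w)]))"
    using fin IH by (intro expectation_mono_finite)
  finally show ?case
    using opt_ge[OF b, of n'] n' advance.prems by (simp add: act_value_def)
next
  case (mix v p q p' q' t)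
  have "base + q + p * LT + (1 - p) * LF \<le> opt n h" (is "?a \<le> _")
    "base + q' + p' * LT + (1 - p') * LF \<le> opt n h" (is "?b \<le> _")
    using mix by blast+
  \<comment> \<open>No coin is tossed in the game: \<open>opt\<close> dominates both policies, hence
    their mixture.\<close>
  then have "t * ?a + (1 - t) * ?b \<le> opt n h"
    using mix.hyps by (intro convex_bound_le) auto
  moreover have "t * ?a + (1 - t) * ?b = base + (t * q + (1 - t) * q') + (t * p + (1 - t) * p') * LT
      + (1 - (t * p + (1 - t) * p')) * LF"
    by (simp add: algebra_simps)
  ultimately show ?case by simp
qed

end

section \<open>Gain collected by a contention resolution scheme\<close>

text \<open>The expected weight accepted in the rest of a run, unrolled into coin weights so that it
  can be compared step by step with \<open>opt\<close>.\<close>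

primrec ocrs_gain ::
  "'i ocrs \<Rightarrow> ('i \<Rightarrow> real) \<Rightarrow> ('i \<Rightarrow> real) \<Rightarrow> 'i list \<Rightarrow> ('i \<times> bool \<times> bool) list \<Rightarrow> real" where
  "ocrs_gain \<psi> x w [] = (\<lambda>g. 0)"
| "ocrs_gain \<psi> x w (i # is) = (\<lambda>g.
     x i * (pmf (\<psi> x g i) True * (w i + ocrs_gain \<psi> x w is (g @ [(i, True, True)]))
            + (1 - pmf (\<psi> x g i) True) * ocrs_gain \<psi> x w is (g @ [(i, True, False)]))
     + (1 - x i) * ocrs_gain \<psi> x w is (g @ [(i, False, False)]))"

section \<open>The law of a run of the scheme\<close>

lemma ocrs_run_Cons_support:
  assumes "act \<in> set_pmf (bernoulli_pmf (x i))"
    and "d \<in> set_pmf (if act then \<psi> x g i else return_pmf False)"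
  shows "set_pmf (ocrs_run \<psi> x (g @ [(i, act, d)]) is) \<subseteq> set_pmf (ocrs_run \<psi> x g (i # is))"
  using assms by auto

lemma ocrs_run_finite: "finite (set_pmf (ocrs_run \<psi> x g is))"
  by (induction "is" arbitrary: g) auto

lemma ocrs_run_extends:
  assumes "g' \<in> set_pmf (ocrs_run \<psi> x g is)"
  shows "\<exists>e. g' = g @ e \<and> map fst e = is"
  using assms
proof (induction "is" arbitrary: g)
  case (Cons i "is")
  then obtain act d where "g' \<in> set_pmf (ocrs_run \<psi> x (g @ [(i, act, d)]) is)"
    by auto
  from Cons.IH[OF this] show ?case by force
qed simp

lemma ocrs_run_expectation_Cons:
  fixes f :: "_ \<Rightarrow> real"
  assumes "0 \<le> x i" "x i \<le> 1"
  shows "measure_pmf.expectation (ocrs_run \<psi> x g (i # is)) f =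
     x i * (pmf (\<psi> x g i) True * measure_pmf.expectation (ocrs_run \<psi> x (g @ [(i, True, True)]) is) f
            + (1 - pmf (\<psi> x g i) True) * measure_pmf.expectation (ocrs_run \<psi> x (g @ [(i, True, False)]) is) f)
     + (1 - x i) * measure_pmf.expectation (ocrs_run \<psi> x (g @ [(i, False, False)]) is) f"
proof -
  have b: "measure_pmf.expectation (D \<bind> k) f = measure_pmf.expectation D (\<lambda>a. measure_pmf.expectation (k a) f)"
    if "\<And>a. finite (set_pmf (k a))" for D :: "bool pmf" and k
    using that by (subst pmf_expectation_bind[where A = UNIV]) (auto simp: integral_measure_pmf[where A = UNIV])
  show ?thesis
    using assms by (simp add: b ocrs_run_finite expectation_bool_pmf)
qed

lemma ocrs_run_prob_Cons:
  assumes "0 \<le> x i" "x i \<le> 1"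
  shows "measure_pmf.prob (ocrs_run \<psi> x g (i # is)) A =
     x i * (pmf (\<psi> x g i) True * measure_pmf.prob (ocrs_run \<psi> x (g @ [(i, True, True)]) is) A
            + (1 - pmf (\<psi> x g i) True) * measure_pmf.prob (ocrs_run \<psi> x (g @ [(i, True, False)]) is) A)
     + (1 - x i) * measure_pmf.prob (ocrs_run \<psi> x (g @ [(i, False, False)]) is) A"
  using ocrs_run_expectation_Cons[where x = x and i = i, OF assms, of \<psi> g "is" "indicator A"] by simp

lemma ocrs_run_prob_1:
  assumes "\<And>e. map fst e = is \<Longrightarrow> g @ e \<in> A"
  shows "measure_pmf.prob (ocrs_run \<psi> x g is) A = 1"
proof -
  have "g' \<in> A" if "g' \<in> set_pmf (ocrs_run \<psi> x g is)" for g'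
    using ocrs_run_extends[OF that] assms by auto
  then show ?thesis
    by (simp add: measure_pmf.prob_eq_1 AE_measure_pmf_iff)
qed

lemma ocrs_run_prob_0:
  assumes "\<And>e. map fst e = is \<Longrightarrow> g @ e \<notin> A"
  shows "measure_pmf.prob (ocrs_run \<psi> x g is) A = 0"
proof -
  have "g' \<notin> A" if "g' \<in> set_pmf (ocrs_run \<psi> x g is)" for g'
    using ocrs_run_extends[OF that] assms by auto
  then show ?thesis
    by (simp add: measure_pmf.prob_eq_0 AE_measure_pmf_iff)
qed

text \<open>The head is accepted while active with probability
  \<open>x i * pmf (\<psi> x g i) True\<close>, and no later record mentions it again; the other
  elements average over the three branches.\<close>

lemma ocrs_gain_eq_sum_prob:
  assumes "distinct is" "set is \<inter> fst ` set g = {}" "\<And>i. i \<in> set is \<Longrightarrow> 0 \<le> x i \<and> x i \<le> 1"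
  shows "ocrs_gain \<psi> x w is g = (\<Sum>i\<in>set is. w i *
     measure_pmf.prob (ocrs_run \<psi> x g is) {g'. (i, True, True) \<in> set g'})"
  using assms
proof (induction "is" arbitrary: g)
  case (Cons i "is")
  have x: "0 \<le> x i" "x i \<le> 1" using Cons.prems by auto
  have i: "i \<notin> set is" "i \<notin> fst ` set g" using Cons.prems by auto
  have IH: "ocrs_gain \<psi> x w is (g @ [(i, act, d)]) = (\<Sum>j\<in>set is. w j *
     measure_pmf.prob (ocrs_run \<psi> x (g @ [(i, act, d)]) is) {g'. (j, True, True) \<in> set g'})" for act d
    using Cons.prems by (intro Cons.IH) auto
  have T: "measure_pmf.prob (ocrs_run \<psi> x (g @ [(i, True, True)]) is) {g'. (i, True, True) \<in> set g'} = 1"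
    by (intro ocrs_run_prob_1) auto
  have F: "measure_pmf.prob (ocrs_run \<psi> x (g @ [(i, act, False)]) is) {g'. (i, True, True) \<in> set g'} = 0" for act
    using i by (intro ocrs_run_prob_0) (force simp: image_iff)
  let ?a = "pmf (\<psi> x g i) True"
  let ?p = "\<lambda>act d j. measure_pmf.prob (ocrs_run \<psi> x (g @ [(i, act, d)]) is) {g'. (j, True, True) \<in> set g'}"
  have "(\<Sum>j\<in>set is. w j * measure_pmf.prob (ocrs_run \<psi> x g (i # is)) {g'. (j, True, True) \<in> set g'})
      = (\<Sum>j\<in>set is. x i * ?a * (w j * ?p True True j) + x i * (1 - ?a) * (w j * ?p True False j)
          + (1 - x i) * (w j * ?p False False j))"
    unfolding ocrs_run_prob_Cons[where x = x and i = i, OF x] by (intro sum.cong refl) algebra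
  also have "\<dots> = x i * ?a * (\<Sum>j\<in>set is. w j * ?p True True j)
      + x i * (1 - ?a) * (\<Sum>j\<in>set is. w j * ?p True False j)
      + (1 - x i) * (\<Sum>j\<in>set is. w j * ?p False False j)"
    by (simp add: sum.distrib sum_distrib_left)
  finally have "(\<Sum>j\<in>set is. w j * measure_pmf.prob (ocrs_run \<psi> x g (i # is)) {g'. (j, True, True) \<in> set g'})
      = \<dots>" .
  moreover have "measure_pmf.prob (ocrs_run \<psi> x g (i # is)) {g'. (i, True, True) \<in> set g'} = x i * ?a"
    unfolding ocrs_run_prob_Cons[where x = x and i = i, OF x] T F by simp
  ultimately show ?case
    using i(1) unfolding ocrs_gain.simps IH
    by (simp del: ocrs_run.simps add: distrib_left mult.assoc mult.left_commute)
qed simp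

text \<open>The activity of \<open>i\<close> is a fresh coin, whatever was recorded before, and
  distinctness excludes a second record of \<open>i\<close>.\<close>

lemma ocrs_run_prob_active:
  assumes "distinct is" "set is \<inter> fst ` set g = {}" "\<And>i. i \<in> set is \<Longrightarrow> 0 \<le> x i \<and> x i \<le> 1" "i \<in> set is"
  shows "measure_pmf.prob (ocrs_run \<psi> x g is) {g'. i \<in> ocrs_active g'} = x i"
  using assms
proof (induction "is" arbitrary: g)
  case (Cons j "is")
  have x: "0 \<le> x j" "x j \<le> 1" using Cons.prems by auto
  show ?case
  proof (cases "i = j")
    case True
    then have i: "i \<notin> set is" "i \<notin> fst ` set g" using Cons.prems by auto
    have T: "measure_pmf.prob (ocrs_run \<psi> x (g @ [(i, True, d)]) is) {g'. i \<in> ocrs_active g'} = 1" for d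
      by (intro ocrs_run_prob_1) (auto simp: ocrs_active_def)
    have F: "measure_pmf.prob (ocrs_run \<psi> x (g @ [(i, False, False)]) is) {g'. i \<in> ocrs_active g'} = 0"
      using i by (intro ocrs_run_prob_0) (force simp: image_iff ocrs_active_def)
    show ?thesis
      using True by (simp add: ocrs_run_prob_Cons[where x = x and i = j, OF x] T[unfolded True] F[unfolded True] del: ocrs_run.simps)
  next
    case False
    have "measure_pmf.prob (ocrs_run \<psi> x (g @ [(j, act, d)]) is) {g'. i \<in> ocrs_active g'} = x i" for act d
      using Cons.prems False by (intro Cons.IH) auto
    then show ?thesis
      by (simp add: ocrs_run_prob_Cons[where x = x and i = j, OF x] algebra_simps del: ocrs_run.simps)
  qed
qed simp

text \<open>Selectability, multiplied by the probability \<open>x i\<close> of activity, bounds the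
  joint probability of activity and acceptance; for \<open>x i = 0\<close> this bound is trivial.
  Nonnegative weights allow summing.\<close>

lemma ocrs_gain_selectable:
  assumes "selectable_ocrs J F PF c \<psi>" "x \<in> PF" "distinct ord" "set ord = J"
    and x: "\<And>i. i \<in> J \<Longrightarrow> 0 \<le> x i \<and> x i \<le> 1"
    and w: "\<And>i. i \<in> J \<Longrightarrow> 0 \<le> w i"
  shows "c * (\<Sum>i\<in>J. x i * w i) \<le> ocrs_gain \<psi> x w ord []"
proof -
  have "c * x i \<le> measure_pmf.prob (ocrs_run \<psi> x [] ord) {g'. (i, True, True) \<in> set g'}" if i: "i \<in> J" for i
  proof (cases "x i = 0")
    case False
    then have pos: "x i > 0" using x[OF i] by auto
    have act: "measure_pmf.prob (ocrs_run \<psi> x [] ord) {g'. i \<in> ocrs_active g'} = x i"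
      using assms i by (intro ocrs_run_prob_active) auto
    have "c \<le> measure_pmf.prob (ocrs_run \<psi> x [] ord) {h. i \<in> ocrs_selected h \<and> i \<in> ocrs_active h} / x i"
    proof -
      have "\<forall>i\<in>J. measure_pmf.prob (ocrs_run \<psi> x [] ord) {h. i \<in> ocrs_active h} > 0 \<longrightarrow>
          c \<le> measure_pmf.prob (ocrs_run \<psi> x [] ord) {h. i \<in> ocrs_selected h \<and> i \<in> ocrs_active h}
            / measure_pmf.prob (ocrs_run \<psi> x [] ord) {h. i \<in> ocrs_active h}"
        using assms(1-4) unfolding selectable_ocrs_def by blast
      from bspec[OF this i] show ?thesis
        unfolding act using pos by simp
    qed
    then have "c * x i \<le> measure_pmf.prob (ocrs_run \<psi> x [] ord) {h. i \<in> ocrs_selected h \<and> i \<in> ocrs_active h}"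
      using pos by (simp add: field_simps)
    \<comment> \<open>Activity and selection could a priori stem from different records of
      \<open>i\<close>; the order is distinct, so there is only one.\<close>
    also have "\<dots> \<le> measure_pmf.prob (ocrs_run \<psi> x [] ord) {g'. (i, True, True) \<in> set g'}"
    proof (rule measure_pmf.finite_measure_mono_AE)
      show "AE g in measure_pmf (ocrs_run \<psi> x [] ord). g \<in> {h. i \<in> ocrs_selected h \<and> i \<in> ocrs_active h}
          \<longrightarrow> g \<in> {g'. (i, True, True) \<in> set g'}"
      proof (unfold AE_measure_pmf_iff, intro ballI impI)
        fix g assume g: "g \<in> set_pmf (ocrs_run \<psi> x [] ord)"
          and "g \<in> {h. i \<in> ocrs_selected h \<and> i \<in> ocrs_active h}"
        then obtain a d where ad: "(i, a, True) \<in> set g" "(i, True, d) \<in> set g"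
          by (auto simp: ocrs_selected_def ocrs_active_def)
        have "distinct (map fst g)"
          using ocrs_run_extends[OF g] assms(3) by auto
        then have "(a, True) = (True, d)"
          using ad by (rule eq_key_imp_eq_value)
        then show "g \<in> {g'. (i, True, True) \<in> set g'}"
          using ad by auto
      qed
    qed simp
    finally show ?thesis .
  qed simp
  then have "(\<Sum>i\<in>J. w i * (c * x i)) \<le> (\<Sum>i\<in>J. w i *
      measure_pmf.prob (ocrs_run \<psi> x [] ord) {g'. (i, True, True) \<in> set g'})"
    using w by (intro sum_mono mult_left_mono) auto
  moreover have "ocrs_gain \<psi> x w ord [] = (\<Sum>i\<in>set ord. w i *
      measure_pmf.prob (ocrs_run \<psi> x [] ord) {g'. (i, True, True) \<in> set g'})"
    using assms by (intro ocrs_gain_eq_sum_prob) auto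
  ultimately show ?thesis
    using assms(4) by (simp add: sum_distrib_left mult_ac)
qed

section \<open>Playing the committed game with the scheme\<close>

context mpoi_game
begin

text \<open>\<open>g\<close> is the simulated record of the scheme and \<open>S\<close> the set won
  in play. Acceptances of faked elements make \<open>S\<close> a mere subset of the scheme's
  selection; downward closure keeps it feasible. The fuel is the ranks of the systems still to come
  plus one for \<open>Stop\<close>.\<close>

lemma opt_ge_ocrs_gain:
  assumes x: "\<And>i. i \<in> J \<Longrightarrow> 0 \<le> x i \<and> x i \<le> 1"
    and u: "\<And>i. i \<in> J \<Longrightarrow> achievable (P i) (T i) (pr i) (r i) (s i) (x i) (u i)"
    and w: "\<And>i. i \<in> J \<Longrightarrow> w i = (if 0 < x i \<and> 0 < u i then u i / x i else 0)"
    and "promised h D S" "S \<subseteq> ocrs_selected g"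
    and "\<forall>g' \<in> set_pmf (ocrs_run \<psi> x g is). ocrs_selected g' \<in> F"
    and "distinct is" "set is \<subseteq> J" "touched h \<inter> set is = {}" "S \<inter> set is = {}"
    and "\<forall>i\<in>set is. cfg s h i = s i"
    and "Suc (\<Sum>i\<leftarrow>is. rank (V i) (P i) (T i) (s i)) \<le> n"
  shows "(\<Sum>k\<in>S. r k (cfg s h k)) + ocrs_gain \<psi> x w is g \<le> opt n h"
  using assms(4-)
proof (induction "is" arbitrary: h D S g n)
  case Nil
  then show ?case using opt_ge_promised by simp
next
  case (Cons i "is")
  define base where "base = (\<Sum>k\<in>S. r k (cfg s h k))"
  define B where "B act d = ocrs_gain \<psi> x w is (g @ [(i, act, d)])" for act d
  define a where "a = pmf (\<psi> x g i) True"
  define m where "m = Suc (\<Sum>i\<leftarrow>is. rank (V i) (P i) (T i) (s i))"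
  have i: "i \<in> J" "i \<notin> S" "i \<notin> set is" using Cons.prems by auto
  have xi: "0 \<le> x i" "x i \<le> 1" using x i by auto
  have a01: "0 \<le> a" "a \<le> 1" by (auto simp: a_def pmf_le_1)
  have finS: "finite S"
    using Cons.prems(1) finite_subset[OF F_subset_J finite_J] unfolding promised_def by blast
  have supp_T: "True \<in> set_pmf (bernoulli_pmf (x i))" if "0 < x i"
    using that xi by (simp add: set_pmf_iff)
  have supp_F: "False \<in> set_pmf (bernoulli_pmf (x i))" if "x i < 1"
    using that xi by (simp add: set_pmf_iff)
  have psi_T: "True \<in> set_pmf (\<psi> x g i)" if "0 < a"
    using that by (simp add: set_pmf_iff a_def)
  have psi_F: "False \<in> set_pmf (\<psi> x g i)" if "a < 1"
    using that by (simp add: set_pmf_iff a_def pmf_False_conv_True)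
  have feas: "\<forall>g' \<in> set_pmf (ocrs_run \<psi> x (g @ [(i, act, d)]) is). ocrs_selected g' \<in> F"
    if "act \<in> set_pmf (bernoulli_pmf (x i))" "d \<in> set_pmf (if act then \<psi> x g i else return_pmf False)" for act d
    using ocrs_run_Cons_support[where x = x and i = i and \<psi> = \<psi> and g = g, OF that, of "is"] Cons.prems(3) by blast
  \<comment> \<open>Nothing is played: \<open>i\<close> stays untouched and its record is made
    up.\<close>
  have skip: "base + B act d \<le> opt n h"
    if "act \<in> set_pmf (bernoulli_pmf (x i))" "d \<in> set_pmf (if act then \<psi> x g i else return_pmf False)" for act d
    unfolding base_def B_def
    by (rule Cons.IH[OF Cons.prems(1) _ feas[OF that]])
      (use Cons.prems in \<open>auto simp: ocrs_selected_def\<close>)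
  \<comment> \<open>A branch of weight 0 needs no bound; feasibility is known only on histories of
    positive probability.\<close>
  have avg: "x i * y + (1 - x i) * z \<le> e"
    if "0 < x i \<Longrightarrow> y \<le> e" "x i < 1 \<Longrightarrow> z \<le> e" for y z e
  proof (cases "x i = 0 \<or> x i = 1")
    case False
    then show ?thesis using that xi by (intro convex_bound_le) auto
  qed (use that in auto)
  have reject: "base + (x i * B True False + (1 - x i) * B False False) \<le> opt n h" if "a < 1"
  proof -
    have "x i * (base + B True False) + (1 - x i) * (base + B False False) \<le> opt n h"
      using skip psi_F[OF that] supp_T supp_F by (intro avg) auto
    then show ?thesis by (simp add: algebra_simps)
  qed
  have accept: "base + (x i * w i + x i * B True True + (1 - x i) * B False False) \<le> opt n h" if "0 < a"
  proof (cases "0 < x i \<and> 0 < u i")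
    case False
    \<comment> \<open>Here \<open>w i = 0\<close>, so nothing is lost by faking the activity of
      \<open>i\<close> even though the scheme would accept.\<close>
    have "x i * (base + B True True) + (1 - x i) * (base + B False False) \<le> opt n h"
      using skip psi_T[OF that] supp_T supp_F by (intro avg) auto
    moreover have "w i = 0" using False w[OF i(1)] by auto
    ultimately show ?thesis by (simp add: algebra_simps)
  next
    case True
    \<comment> \<open>If \<open>x i = 1\<close>, the scheme may misbehave on the impossible history with \<open>i\<close> inactive; its
      weight is 0, so the value of stopping at once will do.\<close>
    define LF where "LF = (if x i < 1 then B False False else 0)"
    have feasT: "\<forall>g' \<in> set_pmf (ocrs_run \<psi> x (g @ [(i, True, True)]) is). ocrs_selected g' \<in> F"
      using True psi_T[OF that] supp_T by (intro feas) auto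
    have subT: "insert i S \<subseteq> ocrs_selected (g @ [(i, True, True)])"
      using Cons.prems(2) by (auto simp: ocrs_selected_def)
    \<comment> \<open>The selection only grows along a run and ends in \<open>F\<close>, so
      \<open>insert i S\<close> is feasible already now.\<close>
    obtain g' where g': "g' \<in> set_pmf (ocrs_run \<psi> x (g @ [(i, True, True)]) is)"
      using set_pmf_not_empty by fast
    have "ocrs_selected (g @ [(i, True, True)]) \<subseteq> ocrs_selected g'"
      using ocrs_run_extends[OF g'] by (auto simp: ocrs_selected_def)
    then have "insert i S \<subseteq> ocrs_selected g'"
      using subT by (rule order_trans[rotated])
    then have iS: "insert i S \<in> F"
      using feasT g' F_subset_closed by blast
    \<comment> \<open>The policy selects \<open>i\<close> with probability \<open>x i\<close>, so
      recording \<open>i\<close> as active exactly when selected has the law of the activity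
      coin.\<close>
    have "base + u i + x i * B True True + (1 - x i) * LF \<le> opt n h"
    proof (rule opt_ge_achievable[OF u[OF i(1)] i(1,2) iS,
          where U = "touched h" and c = "cfg s h" and m = m and D = D])
      fix h' D' n'
      assume h': "m \<le> n'" "promised h' D' (insert i S)" "touched h' \<subseteq> insert i (touched h)"
        "\<forall>k. k \<noteq> i \<longrightarrow> cfg s h' k = cfg s h k"
      have "(\<Sum>k\<in>insert i S. r k (cfg s h' k)) + B True True \<le> opt n' h'"
        unfolding B_def
        by (rule Cons.IH[OF h'(2) subT feasT]) (use Cons.prems h' i m_def in auto)
      moreover have "(\<Sum>k\<in>insert i S. r k (cfg s h' k)) = r i (cfg s h' i) + base"
        using i finS h'(4) by (auto simp: base_def intro!: sum.cong)
      ultimately show "base + r i (cfg s h' i) + B True True \<le> opt n' h'" by simp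
    next
      fix h' D' n'
      assume h': "m \<le> n'" "promised h' D' S" "touched h' \<subseteq> insert i (touched h)"
        "\<forall>k. k \<noteq> i \<longrightarrow> cfg s h' k = cfg s h k"
      have base: "(\<Sum>k\<in>S. r k (cfg s h' k)) = base"
        using i h'(4) by (auto simp: base_def intro!: sum.cong)
      show "base + LF \<le> opt n' h'"
      proof (cases "x i < 1")
        case True
        have feasF: "\<forall>g' \<in> set_pmf (ocrs_run \<psi> x (g @ [(i, False, False)]) is). ocrs_selected g' \<in> F"
          using True supp_F by (intro feas) auto
        have subF: "S \<subseteq> ocrs_selected (g @ [(i, False, False)])"
          using Cons.prems(2) by (auto simp: ocrs_selected_def)
        have "(\<Sum>k\<in>S. r k (cfg s h' k)) + B False False \<le> opt n' h'"
          unfolding B_def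
          by (rule Cons.IH[OF h'(2) subF feasF]) (use Cons.prems h' i m_def in auto)
        then show ?thesis using True base by (simp add: LF_def)
      next
        case False
        then show ?thesis
          using opt_ge_promised[OF h'(2), of n'] h'(1) base by (simp add: LF_def m_def)
      qed
    next
      show "s i \<in> V i" using system[OF i(1)] by (auto simp: markov_system_def)
    qed (use Cons.prems in \<open>auto simp: touched_def m_def\<close>)
    moreover have "(1 - x i) * LF = (1 - x i) * B False False"
      using xi by (auto simp: LF_def)
    moreover have "x i * w i = u i"
      using True w[OF i(1)] by simp
    ultimately show ?thesis by simp
  qed
  \<comment> \<open>The answer of the scheme does not depend on the activity of \<open>i\<close>, so the two coins can be
    drawn in the opposite order.\<close>
  have "base + ocrs_gain \<psi> x w (i # is) g =
      a * (base + (x i * w i + x i * B True True + (1 - x i) * B False False))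
      + (1 - a) * (base + (x i * B True False + (1 - x i) * B False False))"
    by (simp add: B_def a_def algebra_simps)
  also have "\<dots> \<le> opt n h"
  proof (cases "a = 0 \<or> a = 1")
    case False
    then show ?thesis using reject accept a01 by (intro convex_bound_le) auto
  qed (use reject accept in auto)
  finally show ?case by (simp only: base_def)
qed

lemma opt_ge_unconstrained:
  assumes "convex_relaxation J F PF" "0 < c" "selectable_ocrs J F PF c \<psi>"
    and \<sigma>: "valid_strategy False J F P s T \<sigma>"
  shows "c * utility False J V P s pr r \<sigma> \<le> opt (Suc (\<Sum>i\<in>J. card (V i))) []"
proof -
  define N where "N = Suc (\<Sum>i\<in>J. card (V i))"
  define x where "x = sel_prob \<sigma> N []"
  define u where "u = share pr r \<sigma> N []"
  \<comment> \<open>The net value of \<open>i\<close> conditional on its selection, cut off at 0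
    because the scheme needs nonnegative weights; unprofitable systems are skipped.\<close>
  define w where "w i = (if 0 < x i \<and> 0 < u i then u i / x i else 0)" for i
  have xPF: "x \<in> PF"
    unfolding x_def using assms by (intro sel_prob_in_relaxation reach_Nil)
  then have x: "\<And>i. i \<in> J \<Longrightarrow> 0 \<le> x i \<and> x i \<le> 1"
    using assms(1) by (auto simp: convex_relaxation_def)
  have u: "achievable (P i) (T i) (pr i) (r i) (s i) (x i) (u i)" for i
    using share_achievable[OF \<sigma> reach_Nil, of i N] by (simp add: x_def u_def)
  have uw: "u i \<le> x i * w i" if i: "i \<in> J" for i
  proof (cases "x i = 0")
    case True
    \<comment> \<open>The sum of absolute values bounds every destination value; multiplied by the
      probability 0 it leaves \<open>u i \<le> 0\<close>.\<close>
    have "finite (T i)"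
      using system[OF i] finite_subset by (auto simp: markov_system_def)
    then have "r i t \<le> (\<Sum>t\<in>T i. \<bar>r i t\<bar>)" if "t \<in> T i" for t
      using member_le_sum[OF that, of "\<lambda>t. \<bar>r i t\<bar>"] by simp
    then have "u i \<le> (\<Sum>t\<in>T i. \<bar>r i t\<bar>) * x i"
      using achievable_bound[OF u system[OF i]] system[OF i] by (simp add: markov_system_def)
    then show ?thesis using True by simp
  next
    case False
    then show ?thesis using x[OF i] by (auto simp: w_def)
  qed
  obtain ord where ord: "set ord = J" "distinct ord"
    using finite_distinct_list[OF finite_J] by blast
  have "c * utility False J V P s pr r \<sigma> = c * (\<Sum>i\<in>J. u i)"
    unfolding utility_def u_def N_def value_fuel_eq_sum_share[OF \<sigma> reach_Nil] ..
  also have "\<dots> \<le> c * (\<Sum>i\<in>J. x i * w i)"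
    using uw assms(2) by (intro mult_left_mono sum_mono) auto
  also have "\<dots> \<le> ocrs_gain \<psi> x w ord []"
    using assms(3) xPF ord x by (intro ocrs_gain_selectable) (auto simp: w_def)
  also have "\<dots> \<le> opt N []"
  proof -
    \<comment> \<open>Ranks are at most the numbers of states, so the fuel in \<open>utility\<close>
      covers all advances and the final \<open>Stop\<close>.\<close>
    have "(\<Sum>i\<leftarrow>ord. rank (V i) (P i) (T i) (s i)) = (\<Sum>i\<in>J. rank (V i) (P i) (T i) (s i))"
      using ord by (simp add: sum_list_distinct_conv_sum_set)
    also have "\<dots> \<le> (\<Sum>i\<in>J. card (V i))"
      using rank_le_card[OF system] by (intro sum_mono)
    finally have "Suc (\<Sum>i\<leftarrow>ord. rank (V i) (P i) (T i) (s i)) \<le> N"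
      by (simp add: N_def)
    moreover have "promised [] {} {}"
      by (simp add: promised_def empty_in_F)
    moreover have "\<forall>g' \<in> set_pmf (ocrs_run \<psi> x [] ord). ocrs_selected g' \<in> F"
      using assms(3) xPF ord unfolding selectable_ocrs_def by blast
    ultimately have "(\<Sum>k\<in>{}. r k (cfg s [] k)) + ocrs_gain \<psi> x w ord [] \<le> opt N []"
      using x u ord by (intro opt_ge_ocrs_gain[where u = u and D = "{}"]) (auto simp: w_def touched_def)
    then show ?thesis by simp
  qed
  finally show ?thesis by (simp add: N_def)
qed

end

theorem theorem4:
  fixes J :: "'i set" and F :: "'i set set" and PF :: "('i \<Rightarrow> real) set" and \<alpha> :: real
    and V :: "'i \<Rightarrow> 'v set" and P :: "'i \<Rightarrow> 'v \<Rightarrow> 'v pmf" and s :: "'i \<Rightarrow> 'v"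
    and T :: "'i \<Rightarrow> 'v set" and pr :: "'i \<Rightarrow> 'v \<Rightarrow> real" and r :: "'i \<Rightarrow> 'v \<Rightarrow> real"
  assumes "finite J"
    and "downward_closed_family J F"
    and "convex_relaxation J F PF"
    and "\<alpha> \<ge> 1"
    and "\<exists>\<psi>. selectable_ocrs J F PF (1 / \<alpha>) \<psi>"
    and "\<forall>i \<in> J. dag_markov_system (V i) (P i) (s i) (T i) (pr i) (r i)"
    and "\<forall>i \<in> J. \<forall>t \<in> T i. r i t \<ge> 0"
  shows "\<exists>\<sigma>. valid_strategy True J F P s T \<sigma> \<and>
           (\<forall>\<sigma>'. valid_strategy False J F P s T \<sigma>' \<longrightarrow>
              utility True J V P s pr r \<sigma> \<ge> (1 / \<alpha>) * utility False J V P s pr r \<sigma>')"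
proof -
  interpret mpoi_game J F V P s T pr r
    using assms by unfold_locales auto
  obtain \<psi> where \<psi>: "selectable_ocrs J F PF (1 / \<alpha>) \<psi>"
    using assms by blast
  obtain \<sigma> where \<sigma>: "valid_strategy True J F P s T \<sigma>"
    "utility True J V P s pr r \<sigma> = opt (Suc (\<Sum>i\<in>J. card (V i))) []"
    using opt_attained unfolding utility_def by metis
  show ?thesis
    using \<sigma> opt_ge_unconstrained[OF assms(3) _ \<psi>] assms(4) by (intro exI[of _ \<sigma>]) simp
qed

end
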